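(* Let $k$ and $\ell$ be any positive integers. Then the matrix $B_k^{\ell-2}$ is a fragmented matrix.
   Context: $C^a_b$ denotes the binomial coefficient "$a$ choose $b$". $I_p$ is the $p\times p$ identity matrix and $J_p$ is the $p\times p$ all-ones matrix minus $I_p$. If $X$ has $m$ columns and $Y$ is $m\times m$, then $X(Y)$ denotes the matrix obtained by pasting $Y$ below $X$. For $X$ of order $n_1\times m_1$ and $Y$ of order $n_2\times m_2$ with $n_1\ge n_2$, $X\sqcup Y$ is the $n_1\times(m_1+m_2)$ matrix obtained by placing $Y$ to the right of $X$ with the bottom rows aligned and filling the remaining upper right $(n_1-n_2)\times m_2$ block with ones; longer expressions are formed from left to right. The matrices $B_k^{j}$ ($k\ge1$, $j\ge-1$): $B_k^{-1}=(0,\ldots,0)$ of order $1\times k$ and, for $j\ge0$, $B_k^{j}=B_k^{j-1}(J_{C^{k+j}_{j+1}})\sqcup B_{k-1}^{j-1}(J_{C^{k-1+j}_{j+1}})\sqcup\cdots\sqcup B_1^{j-1}(J_{C^{1+j}_{j+1}})$, where the pasted square matrices have as many rows as the matrix above them has columns. Fragmented matrix: let $n,m,r,s$ be positive integers such that $m>n$ and $n-s=m-r>0$; let $M$ be a matrix of order $n\times m$, $X$ a matrix of order $s\times(m-r)$, $Y$ a square matrix of order $(m-r)\times(n-s)$ and $Z$ a matrix of order $(n-s)\times r$. Then $M$ is called a fragmented matrix if $M=X(Y)\sqcup Z$.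
   Formalization: Proved for 2 ≤ ℓ < k only: B_k^{ℓ-2} has order C(k+ℓ-1,ℓ-1) × C(k+ℓ-1,ℓ), so the required m > n fails whenever k ≤ ℓ (e.g. k = ℓ = 1), and for ℓ = 1 it has a single row, so s > 0 and n - s > 0 cannot both hold. *)

theory Defs
  imports "Jordan_Normal_Form.Matrix"
begin

definition J_mat :: "nat \<Rightarrow> 'a::ring_1 mat" where
  "J_mat p = mat p p (\<lambda>_. 1) - 1\<^sub>m p"

(* The operation X(Y), pasting Y below X, is append_rows from Jordan_Normal_Form, written @\<^sub>r. *)

(* Only meaningful for dim_row Y \<le> dim_row X. *)
definition beside :: "'a::one mat \<Rightarrow> 'a mat \<Rightarrow> 'a mat"  (infixl "\<squnion>\<^sub>m" 64) where
  "X \<squnion>\<^sub>m Y = mat (dim_row X) (dim_col X + dim_col Y)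
     (\<lambda>(i, j).
        if j < dim_col X then X $$ (i, j)
        else if i < dim_row X - dim_row Y then 1
        else Y $$ (i - (dim_row X - dim_row Y), j - dim_col X))"

(* B_shift p k is B_k^{p-1}: the superscript, which starts at -1, is shifted to a natural number.
   In the second equation, j = p, so the pasted blocks have order C^{i+j}_{j+1} for
   i = k, k-1, ..., 1, and the expression is formed from left to right. *)
fun B_shift :: "nat \<Rightarrow> nat \<Rightarrow> 'a::ring_1 mat" where
  "B_shift 0 k = 0\<^sub>m 1 k"
| "B_shift (Suc p) k =
     foldl (\<squnion>\<^sub>m) (B_shift p k @\<^sub>r J_mat ((k + p) choose (p + 1)))
       (map (\<lambda>i. B_shift p i @\<^sub>r J_mat ((i + p) choose (p + 1))) (rev [1..<k]))"

(* Only meant for k \<ge> 1 and j \<ge> -1. *)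
definition B_mat :: "nat \<Rightarrow> int \<Rightarrow> 'a::ring_1 mat" where
  "B_mat k j = B_shift (nat (j + 1)) k"

definition fragmented :: "'a::ring_1 mat \<Rightarrow> bool" where
  "fragmented M \<longleftrightarrow>
     (\<exists>n m r s X Y Z.
        0 < n \<and> 0 < m \<and> 0 < r \<and> 0 < s \<and> n < m \<and>
        int n - int s = int m - int r \<and> int m - int r > 0 \<and>
        M \<in> carrier_mat n m \<and>
        X \<in> carrier_mat s (m - r) \<and>
        Y \<in> carrier_mat (m - r) (n - s) \<and>
        Z \<in> carrier_mat (n - s) r \<and>
        M = (X @\<^sub>r Y) \<squnion>\<^sub>m Z)"

end

theory Submission
  imports Defs
begin

text \<open>
  Placing matrices side by side is associative as long as the row numbers do not increase, so
  regrouping the defining expression gives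
  \<open>B\<^sub>k\<^sup>j = B\<^sub>k\<^sup>j\<^sup>-\<^sup>1(J) \<squnion> B\<^sub>k\<^sub>-\<^sub>1\<^sup>j\<close>.
  Since \<open>B\<^sub>k\<^sup>j\<close> has order \<open>C\<^sup>k\<^sup>+\<^sup>j\<^sup>+\<^sup>1\<^sub>j\<^sub>+\<^sub>1 \<times> C\<^sup>k\<^sup>+\<^sup>j\<^sup>+\<^sup>1\<^sub>j\<^sub>+\<^sub>2\<close>, the matrix \<open>B\<^sub>k\<^sub>-\<^sub>1\<^sup>j\<close> has as many
  rows as \<open>J\<close>, and this is a fragmentation.
\<close>

lemma dim_beside [simp]:
  "dim_row (X \<squnion>\<^sub>m Y) = dim_row X"
  "dim_col (X \<squnion>\<^sub>m Y) = dim_col X + dim_col Y"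
  by (simp_all add: beside_def)

lemma dim_append_rows [simp]:
  "dim_row (X @\<^sub>r Y) = dim_row X + dim_row Y"
  "dim_col (X @\<^sub>r Y) = dim_col X"
  by (simp_all add: append_rows_def)

lemma dim_J_mat [simp]: "dim_row (J_mat p) = p" "dim_col (J_mat p) = p"
  by (simp_all add: J_mat_def)

text \<open>Both groupings align the blocks at the bottom with ones above; the row bounds make the
  truncated subtractions exact.\<close>

lemma beside_assoc:
  assumes "dim_row Z \<le> dim_row Y" "dim_row Y \<le> dim_row X"
  shows "(X \<squnion>\<^sub>m Y) \<squnion>\<^sub>m Z = X \<squnion>\<^sub>m (Y \<squnion>\<^sub>m Z)"
  using assms by (intro eq_matI) (auto simp: beside_def)

text \<open>\<open>Y\<close> varies because it absorbs the blocks of \<open>Zs\<close> one by one;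
  its row number stays fixed, so the bounds survive.\<close>

lemma foldl_beside:
  assumes "dim_row Y \<le> dim_row X" "\<And>Z. Z \<in> set Zs \<Longrightarrow> dim_row Z \<le> dim_row Y"
  shows "foldl (\<squnion>\<^sub>m) (X \<squnion>\<^sub>m Y) Zs = X \<squnion>\<^sub>m foldl (\<squnion>\<^sub>m) Y Zs"
  using assms by (induction Zs arbitrary: Y) (simp_all add: beside_assoc)

lemma dim_row_foldl_beside [simp]: "dim_row (foldl (\<squnion>\<^sub>m) X Ys) = dim_row X"
  by (induction Ys arbitrary: X) simp_all

lemma dim_row_B_shift: "dim_row (B_shift p k) = (k + p) choose p"
  by (induction p) simp_all

lemma B_shift_Suc_Suc:
  assumes "0 < k"
  shows "B_shift (Suc p) (Suc k) =
    (B_shift p (Suc k) @\<^sub>r J_mat ((Suc k + p) choose (p + 1))) \<squnion>\<^sub>m B_shift (Suc p) k"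
proof -
  define F where "F i = B_shift p i @\<^sub>r (J_mat ((i + p) choose (p + 1)) :: 'a mat)" for i
  have row_F: "dim_row (F i) = (i + Suc p) choose Suc p" for i
    by (simp add: F_def dim_row_B_shift)
  have mono: "dim_row (F i) \<le> dim_row (F j)" if "i \<le> j" for i j
    unfolding row_F using that by (intro binomial_right_mono) simp
  \<comment> \<open>As \<open>0 < k\<close>, the index list for \<open>Suc k\<close> starts with
    \<open>k\<close>: the left fold is \<open>B_shift (Suc p) (Suc k)\<close>, the right one
    \<open>B_shift (Suc p) k\<close>.\<close>
  have "foldl (\<squnion>\<^sub>m) (F (Suc k) \<squnion>\<^sub>m F k) (map F (rev [1..<k])) =
      F (Suc k) \<squnion>\<^sub>m foldl (\<squnion>\<^sub>m) (F k) (map F (rev [1..<k]))"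
    by (intro foldl_beside) (auto intro: mono)
  with assms show ?thesis
    by (simp add: F_def [abs_def])
qed

text \<open>The first block and the remaining matrix contribute the two summands of Pascal's
  rule.\<close>

lemma dim_col_B_shift: "dim_col (B_shift p k) = (k + p) choose (p + 1)"
proof (induction p arbitrary: k)
  case 0
  then show ?case by simp
next
  case (Suc p)
  show ?case
  proof (induction k)
    case 0
    show ?case using Suc.IH[of 0] by simp
  next
    case (Suc k)
    show ?case
    proof (cases "k = 0")
      case True
      then show ?thesis using \<open>\<And>k. dim_col (B_shift p k) = _\<close>[of 1] by simp
    next
      case False
      then show ?thesis
        using \<open>\<And>k. dim_col (B_shift p k) = _\<close>[of "Suc k"] Suc.IH
        by (simp add: B_shift_Suc_Suc del: B_shift.simps)
    qed
  qed
qed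

theorem theorem4p4:
  fixes k l :: nat
  assumes "0 < k" and "0 < l"
    and "2 \<le> l" and "l < k"
  shows "fragmented (B_mat k (int l - 2) :: 'a::ring_1 mat)"
proof -
  obtain p where l: "l = p + 2"
    using \<open>2 \<le> l\<close> by (metis le_add_diff_inverse2)
  obtain h where k: "k = Suc h" and h: "p + 1 < h"
    using \<open>l < k\<close> l by (cases k) auto
  define t where "t = (k + p) choose (p + 1)"
  define M :: "'a mat" where "M = B_shift (Suc p) k"
  define X :: "'a mat" where "X = B_shift p k"
  define Z :: "'a mat" where "Z = B_shift (Suc p) h"
  have "int l - 2 + 1 = int (Suc p)"
    using l by simp
  then have M_eq: "B_mat k (int l - 2) = M"
    unfolding B_mat_def M_def by (metis nat_int)
  have split: "M = (X @\<^sub>r J_mat t) \<squnion>\<^sub>m Z"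
    using h unfolding M_def X_def Z_def t_def k by (intro B_shift_Suc_Suc) simp
  have X: "dim_row X = (k + p) choose p" "dim_col X = t"
    by (simp_all add: X_def t_def dim_row_B_shift dim_col_B_shift)
  have Z: "dim_row Z = t" "dim_col Z = (h + p + 1) choose (p + 2)"
    by (simp_all add: Z_def t_def k dim_row_B_shift dim_col_B_shift del: B_shift.simps)
  have pos: "0 < dim_row X" "0 < dim_col Z" "0 < t"
    using h k by (simp_all add: X Z t_def)
  \<comment> \<open>\<open>l < k\<close> amounts to \<open>2 * (p + 2) \<le> k + p + 1\<close>, the
    range where binomials still increase.\<close>
  have "(k + p + 1) choose (p + 1) < (k + p + 1) choose (p + 2)"
    using h k by (intro binomial_strict_mono) simp_all
  then have less: "dim_row M < dim_col M"
    by (simp add: M_def dim_row_B_shift dim_col_B_shift del: B_shift.simps binomial_Suc_Suc)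
  have dims: "dim_row M = dim_row X + t" "dim_col M = t + dim_col Z"
    by (simp_all add: split X)
  \<comment> \<open>With these witnesses \<open>n - s\<close> and \<open>m - r\<close> both equal
    \<open>t\<close>.\<close>
  show ?thesis
    unfolding M_eq fragmented_def
    using pos less dims X(2) Z(1) split
    by (intro exI[of _ "dim_row M"] exI[of _ "dim_col M"] exI[of _ "dim_col Z"]
        exI[of _ "dim_row X"] exI[of _ X] exI[of _ "J_mat t"] exI[of _ Z])
      auto
qed

end
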